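(* Let $\xi=(\tau_L,\delta_L,\tau_R,\delta_R)\in\Phi_{\rm BYG}$ and suppose $J_1(\xi)>1$ and $\lambda_L^s+|\lambda_R^s|<1$. Then there is a filled triangle in $\mathbb{R}^2$ that contains $\Lambda$ and in which the stable manifold $W^s(X)$ is dense.
   Context: For $\xi=(\tau_L,\delta_L,\tau_R,\delta_R)\in\mathbb{R}^4$ define the continuous piecewise-linear map $f_\xi:\mathbb{R}^2\to\mathbb{R}^2$ by $f_\xi(x,y)=(\tau_L x+y+1,\,-\delta_L x)$ if $x\le 0$ and $f_\xi(x,y)=(\tau_R x+y+1,\,-\delta_R x)$ if $x\ge 0$. Let $A_L=\begin{bmatrix}\tau_L&1\\-\delta_L&0\end{bmatrix}$ and $A_R=\begin{bmatrix}\tau_R&1\\-\delta_R&0\end{bmatrix}$. Let $\Phi=\{\xi\in\mathbb{R}^4: \tau_L>\delta_L+1,\ \delta_L>0,\ \tau_R<-(\delta_R+1),\ \delta_R>0\}$. For $\xi\in\Phi$ the eigenvalues of $A_L$ are real with $0<\lambda_L^s<1<\lambda_L^u$, the eigenvalues of $A_R$ are real with $\lambda_R^u<-1<\lambda_R^s<0$, $f_\xi$ is a homeomorphism, and $f_\xi$ has the two saddle fixed points $X=\left(\frac{1}{\delta_R+1-\tau_R},\frac{-\delta_R}{\delta_R+1-\tau_R}\right)$ and $Y=\left(\frac{-1}{\tau_L-\delta_L-1},\frac{\delta_L}{\tau_L-\delta_L-1}\right)$. Let $\phi(\xi)=\delta_R-\left(\tau_R+\delta_L+\delta_R-(1+\tau_R)\lambda_L^u\right)\lambda_L^u$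 and $\Phi_{\rm BYG}=\{\xi\in\Phi:\phi(\xi)>0\}$. Let $J_1(\xi)=\frac{\lambda_L^u(\lambda_R^u)^2}{\lambda_L^u+|\lambda_R^u|}$. The stable manifold is $W^s(X)=\{P\in\mathbb{R}^2: f_\xi^n(P)\to X \text{ as } n\to\infty\}$ and the unstable manifold is $W^u(X)=\{P\in\mathbb{R}^2: f_\xi^{-n}(P)\to X \text{ as } n\to\infty\}$. Let $\Lambda$ be the closure of $W^u(X)$. *)

theory Defs
  imports "HOL-Analysis.Analysis"
begin

definition bcnf :: "real \<Rightarrow> real \<Rightarrow> real \<Rightarrow> real \<Rightarrow> real \<times> real \<Rightarrow> real \<times> real" where
  "bcnf tL dL tR dR P = (let x = fst P; y = snd P in
      if x \<le> 0 then (tL * x + y + 1, - dL * x) else (tR * x + y + 1, - dR * x))"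

definition Phi :: "real \<Rightarrow> real \<Rightarrow> real \<Rightarrow> real \<Rightarrow> bool" where
  "Phi tL dL tR dR \<longleftrightarrow> tL > dL + 1 \<and> dL > 0 \<and> tR < - (dR + 1) \<and> dR > 0"

text \<open>Eigenvalues of A_L = [[tL,1],[-dL,0]] (0 < lamLs < 1 < lamLu) and of
  A_R = [[tR,1],[-dR,0]] (lamRu < -1 < lamRs < 0), for parameters in Phi.\<close>
definition lamLu :: "real \<Rightarrow> real \<Rightarrow> real" where
  "lamLu tL dL = (tL + sqrt (tL\<^sup>2 - 4 * dL)) / 2"
definition lamLs :: "real \<Rightarrow> real \<Rightarrow> real" where
  "lamLs tL dL = (tL - sqrt (tL\<^sup>2 - 4 * dL)) / 2"
definition lamRu :: "real \<Rightarrow> real \<Rightarrow> real" where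
  "lamRu tR dR = (tR - sqrt (tR\<^sup>2 - 4 * dR)) / 2"
definition lamRs :: "real \<Rightarrow> real \<Rightarrow> real" where
  "lamRs tR dR = (tR + sqrt (tR\<^sup>2 - 4 * dR)) / 2"

definition phiBYG :: "real \<Rightarrow> real \<Rightarrow> real \<Rightarrow> real \<Rightarrow> real" where
  "phiBYG tL dL tR dR = dR - (tR + dL + dR - (1 + tR) * lamLu tL dL) * lamLu tL dL"

definition J1 :: "real \<Rightarrow> real \<Rightarrow> real \<Rightarrow> real \<Rightarrow> real" where
  "J1 tL dL tR dR = lamLu tL dL * (lamRu tR dR)\<^sup>2 / (lamLu tL dL + \<bar>lamRu tR dR\<bar>)"

definition fixX :: "real \<Rightarrow> real \<Rightarrow> real \<times> real" where
  "fixX tR dR = (1 / (dR + 1 - tR), - dR / (dR + 1 - tR))"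

definition stable_manifold :: "('a \<Rightarrow> 'a) \<Rightarrow> 'a::topological_space \<Rightarrow> 'a set" where
  "stable_manifold f X = {P. (\<lambda>n. (f ^^ n) P) \<longlonglongrightarrow> X}"

text \<open>Unstable manifold: backward iterates under the inverse map converge (f is a homeomorphism on Phi).\<close>
definition unstable_manifold :: "('a \<Rightarrow> 'a) \<Rightarrow> 'a::topological_space \<Rightarrow> 'a set" where
  "unstable_manifold f X = {P. (\<lambda>n. (inv f ^^ n) P) \<longlonglongrightarrow> X}"

definition filled_triangle :: "(real \<times> real) set \<Rightarrow> bool" where
  "filled_triangle T \<longleftrightarrow> (\<exists>a b c. \<not> collinear {a, b, c} \<and> T = convex hull {a, b, c})"

end

theory Submission
  imports Defs
begin

text \<open>Write \<open>l = \<lambda>\<^sub>L\<^sup>s\<close>, \<open>a = \<bar>\<lambda>\<^sub>R\<^sup>u\<bar>\<close>, \<open>b = \<bar>\<lambda>\<^sub>R\<^sup>s\<bar>\<close>. The triangle \<open>T\<close> is bounded by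
  the unstable line of \<open>Y\<close>, which meets the \<open>x\<close>-axis at \<open>(D, 0)\<close>, the stable line of \<open>Y\<close>, and the line
  through \<open>(D, 0)\<close> and its image. It is forward invariant and contains \<open>X\<close> in its interior,
  so it contains the unstable manifold. For the density, consider a segment in \<open>T\<close> whose slope lies
  in the invariant cone \<open>[-l, b]\<close> and which avoids \<open>W\<^sup>s(X)\<close>. As long as it does not cross the
  switching line, its horizontal extent grows under the map by at least \<open>min \<lambda>\<^sub>L\<^sup>u a\<close>. When it does
  cross, two iterates of one of the two pieces give an extent larger by the factor \<open>J1\<close>, because
  \<open>l + b < 1\<close> makes the stable line of \<open>X\<close> separate the relevant part of \<open>T\<close> from the left
  half-plane. Since \<open>T\<close> is bounded, no such segment exists.\<close>

section \<open>Triangles described by cross products\<close>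

text \<open>The three cross products, divided by their sum \<open>N\<close> (twice the signed area),
  are the barycentric coordinates of the point.\<close>

lemma mem_triangle_hull:
  fixes ax ay bx by' cx cy x y :: real
  defines "cr \<equiv> \<lambda>px py qx qy x y. (qx - px) * (y - py) - (qy - py) * (x - px)"
  assumes pos: "cr ax ay bx by' cx cy > 0"
    and "cr ax ay bx by' x y \<ge> 0" "cr bx by' cx cy x y \<ge> 0" "cr cx cy ax ay x y \<ge> 0"
  shows "(x, y) \<in> convex hull {(ax, ay), (bx, by'), (cx, cy)}"
proof -
  define N where "N = cr ax ay bx by' cx cy"
  define u where "u = cr bx by' cx cy x y"
  define v where "v = cr cx cy ax ay x y"
  define w where "w = cr ax ay bx by' x y"
  have N: "N > 0" and nn: "u \<ge> 0" "v \<ge> 0" "w \<ge> 0"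
    using assms by (auto simp: N_def u_def v_def w_def)
  have s: "u + v + w = N"
    and sx: "u * ax + v * bx + w * cx = N * x" and sy: "u * ay + v * by' + w * cy = N * y"
    unfolding u_def v_def w_def N_def cr_def by algebra+
  have "u / N + v / N + w / N = 1"
    using s N by (metis add_divide_distrib div_self less_irrefl)
  moreover have "(x, y) = (u / N) *\<^sub>R (ax, ay) + (v / N) *\<^sub>R (bx, by') + (w / N) *\<^sub>R (cx, cy)"
    using sx sy N by (simp add: field_simps)
  moreover have "u / N \<ge> 0" "v / N \<ge> 0" "w / N \<ge> 0"
    using nn N by auto
  ultimately show ?thesis
    unfolding convex_hull_3 by blast
qed

lemma not_collinear_if_cross_pos:
  fixes ax ay bx by' cx cy :: real
  assumes "(bx - ax) * (cy - ay) - (by' - ay) * (cx - ax) > 0"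
  shows "\<not> collinear {(ax, ay), (bx, by'), (cx, cy)}"
proof
  assume "collinear {(ax, ay), (bx, by'), (cx, cy)}"
  then obtain u where u: "\<forall>p\<in>{(ax, ay), (bx, by'), (cx, cy)}. \<forall>q\<in>{(ax, ay), (bx, by'), (cx, cy)}.
      \<exists>c. p - q = c *\<^sub>R u"
    unfolding collinear_def by blast
  obtain c d where "(bx, by') - (ax, ay) = c *\<^sub>R u" "(cx, cy) - (ax, ay) = d *\<^sub>R u"
    using u by (metis insertI1 insertI2)
  then have "bx - ax = c * fst u" "by' - ay = c * snd u" "cx - ax = d * fst u" "cy - ay = d * snd u"
    by (auto simp: prod_eq_iff)
  then show False
    using assms by (simp add: mult.commute mult.left_commute)
qed

section \<open>The map and the triangle in terms of the eigenvalues\<close>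

text \<open>Here \<open>lam\<close> is \<open>\<lambda>\<^sub>L\<^sup>u\<close>. Working with
  eigenvalues keeps square roots out: the traces are \<open>lam + l\<close> and
  \<open>- (a + b)\<close>, the determinants \<open>lam * l\<close> and \<open>a * b\<close>.
  \<open>phi\<close> and \<open>J\<close> express \<open>phiBYG > 0\<close> and
  \<open>J1 > 1\<close>.\<close>

locale byg =
  fixes lam l a b :: real
  assumes lam: "lam > 1" and l: "l > 0" and a: "a > 1" and b: "b > 0" and lb: "l + b < 1"
    and phi: "a * b - (- (a + b) + lam * l + a * b - (1 - (a + b)) * lam) * lam > 0"
    and J: "lam * a\<^sup>2 / (lam + a) > 1"
begin

text \<open>The slope of the line through \<open>(D, 0)\<close> and its image is \<open>m\<close>.\<close>

definition "f = bcnf (lam + l) (lam * l) (- (a + b)) (a * b)"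
definition "X = fixX (- (a + b)) (a * b)"
definition "W = stable_manifold f X"
definition "D = 1 / (1 - l)"
definition "m = a * b / (a + b + l)"
text \<open>The boundaries are, in order, the unstable line of \<open>Y\<close> (top, slope
  \<open>- l\<close>), the stable line of \<open>Y\<close> (left, slope \<open>- lam\<close>) and
  the line through \<open>(D, 0)\<close> and its image (bottom, slope \<open>m\<close>).\<close>

definition "T = {P. snd P + l * fst P \<le> l * D \<and> snd P + lam * fst P \<ge> - lam / (lam - 1)
  \<and> snd P \<ge> m * (fst P - D)}"

lemma f_left: "fst P \<le> 0 \<Longrightarrow> f P = ((lam + l) * fst P + snd P + 1, - (lam * l) * fst P)"
  by (simp add: f_def bcnf_def Let_def)

lemma f_right: "fst P \<ge> 0 \<Longrightarrow> f P = (snd P + 1 - (a + b) * fst P, - (a * b) * fst P)"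
  by (cases "fst P = 0") (simp_all add: f_def bcnf_def Let_def algebra_simps)

lemma X_eq: "X = (1 / ((1 + a) * (1 + b)), - (a * b) / ((1 + a) * (1 + b)))"
  by (simp add: X_def fixX_def algebra_simps)

lemma l_less_1: "l < 1" using lb b by simp

lemma D_eq: "D - l * D = 1" "D > 1" "l * D > 0"
  using l l_less_1 by (auto simp: D_def field_simps)

lemma m_eq: "m * (a + b + l) = a * b"
  using l a b by (simp add: m_def)

lemma m_pos: "m > 0"
  using l a b by (simp add: m_def)

lemma m_less_b: "m < b"
proof -
  have "a * b < b * (a + b + l)" using l b by (simp add: algebra_simps add_pos_pos)
  then show ?thesis using l a b by (simp add: m_def field_simps)
qed

section \<open>Forward invariance of the triangle\<close>

lemma mem_T_fst_le: assumes "P \<in> T" shows "fst P \<le> D"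
proof -
  have "(m + l) * (fst P - D) \<le> 0" using assms by (simp add: T_def algebra_simps)
  then show ?thesis using m_pos l by (simp add: mult_le_0_iff)
qed

text \<open>Makes \<open>inv f\<close> a right inverse of \<open>f\<close>. The sign of the second
  coordinate of the target tells which branch to invert.\<close>

lemma surj_f: "surj f"
proof -
  have "\<exists>P. f P = (u, v)" for u v
  proof (cases "v \<ge> 0")
    case True
    then have "- v / (lam * l) \<le> 0" using lam l by simp
    then show ?thesis
      using lam l by (intro exI[of _ "(- v / (lam * l), u - 1 + (lam + l) * (v / (lam * l)))"])
        (simp add: f_left)
  next
    case False
    then have "- v / (a * b) \<ge> 0" using a b by (simp add: field_simps)
    then show ?thesis
      using a b by (intro exI[of _ "(- v / (a * b), u - 1 - (a + b) * (v / (a * b)))"])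
        (simp add: f_right)
  qed
  then show ?thesis by (metis surj_def surj_pair)
qed

text \<open>The positivity of \<open>phiBYG\<close> says that the image of the vertex \<open>(D, 0)\<close> lies
  on the right of the stable line of the left fixed point.\<close>

lemma f_vertex: "- (a * b) * D + lam * (1 - (a + b) * D) > - lam / (lam - 1)"
proof -
  have D: "D * (1 - l) = 1" and e: "lam / (lam - 1) * (lam - 1) = lam"
    using l_less_1 lam by (auto simp: D_def)
  \<comment> \<open>A variable \<open>e\<close> stands for the quotient
    \<open>lam / (lam - 1)\<close>, which makes the identity polynomial; clearing denominators
    yields exactly the expression in \<open>phi\<close>.\<close>
  have "(- (a * b) * D + lam * (1 - (a + b) * D) + e) * ((lam - 1) * (1 - l))
      = a * b - (- (a + b) + lam * l + a * b - (1 - (a + b)) * lam) * lam"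
    if e: "e * (lam - 1) = lam" for e
  proof -
    have "(- (a * b) * D + lam * (1 - (a + b) * D) + e) * ((lam - 1) * (1 - l))
      = (- (a * b) - lam * (a + b)) * (D * (1 - l)) * (lam - 1) + lam * (lam - 1) * (1 - l)
        + e * (lam - 1) * (1 - l)"
      by (simp add: algebra_simps)
    then show ?thesis unfolding D e by (simp add: algebra_simps)
  qed
  from this[OF e] have "(- (a * b) * D + lam * (1 - (a + b) * D) + lam / (lam - 1)) * ((lam - 1) * (1 - l))
      = a * b - (- (a + b) + lam * l + a * b - (1 - (a + b)) * lam) * lam"
    (is "?Q * _ = _") .
  then have "?Q * ((lam - 1) * (1 - l)) > 0" using phi by simp
  moreover have "(lam - 1) * (1 - l) > 0" using lam l_less_1 by simp
  ultimately have "?Q > 0" by (simp only: zero_less_mult_pos2)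
  then show ?thesis by simp
qed

lemma f_T: assumes P: "P \<in> T" shows "f P \<in> T"
proof -
  obtain x y where xy: "P = (x, y)" by fastforce
  have h: "y + l * x \<le> l * D" "y + lam * x \<ge> - lam / (lam - 1)" "y \<ge> m * (x - D)"
    using P by (auto simp: T_def xy)
  have xD: "x \<le> D" using mem_T_fst_le[OF P] by (simp add: xy)
  show ?thesis
  proof (cases "x \<le> 0")
    case True
    define x' where "x' = (lam + l) * x + y + 1"
    have f: "f P = (x', - (lam * l) * x)" using True by (simp add: f_left xy x'_def)
    \<comment> \<open>On the left branch \<open>y + l * x\<close> and \<open>y + lam * x\<close>
      are, up to constants, multiplied by \<open>l\<close> and \<open>lam\<close>; their bounding
      values in \<open>T\<close> are the fixed ones.\<close>
    have "l * (y + l * x + 1) \<le> l * (l * D + 1)" using h l by simp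
    also have "\<dots> = l * D" using D_eq by simp
    finally have 1: "- (lam * l) * x + l * x' \<le> l * D"
      by (simp add: x'_def algebra_simps)
    have "lam * (y + lam * x + 1) \<ge> lam * (- lam / (lam - 1) + 1)" using h lam by simp
    moreover have "lam * (- lam / (lam - 1) + 1) = - lam / (lam - 1)"
      using lam by (simp add: field_simps)
    ultimately have 2: "- (lam * l) * x + lam * x' \<ge> - lam / (lam - 1)"
      by (simp add: x'_def algebra_simps)
    have y': "- (lam * l) * x \<ge> 0" using True lam l by (simp add: mult_le_0_iff)
    then have "l * x' \<le> l * D" using 1 by linarith
    then have "m * (x' - D) \<le> 0" using l m_pos by (simp add: mult_le_0_iff)
    then show ?thesis using 1 2 y' by (simp add: T_def f)
  next
    case False
    define x' where "x' = y + 1 - (a + b) * x"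
    have f: "f P = (x', - (a * b) * x)" using False by (simp add: f_right xy x'_def)
    have x: "x \<ge> 0" using False by simp
    have p: "a * b * x \<ge> 0" "(a + b) * x \<ge> 0" "l * x \<ge> 0" using a b l x by auto
    have yl: "y \<le> l * D" using h p by linarith
    then have "x' \<le> D" using p D_eq by (simp add: x'_def)
    then have "l * x' \<le> l * D" using l by simp
    then have 1: "- (a * b) * x + l * x' \<le> l * D" using p unfolding mult_minus_left by linarith
    \<comment> \<open>The left-edge functional of the image increases in \<open>y\<close> and,
      because \<open>m < b\<close>, decreases in \<open>x\<close> along the bottom line. Its worst
      case is the vertex \<open>(D, 0)\<close>, settled by \<open>f_vertex\<close>.\<close>
    have "lam * m \<le> lam * (a + b)" "a * b > 0" using m_less_b lam a b by auto
    then have "(a * b + lam * (a + b) - lam * m) * (D - x) \<ge> 0"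
      using xD by (intro mult_nonneg_nonneg) auto
    moreover have "lam * y \<ge> lam * (m * (x - D))" using h lam by simp
    ultimately have 2: "- (a * b) * x + lam * x' \<ge> - lam / (lam - 1)"
      using f_vertex by (simp add: x'_def algebra_simps)
    \<comment> \<open>The right branch sends the top line into the bottom line:
      \<open>(0, l * D)\<close> goes to \<open>(D, 0)\<close>, and \<open>(D, 0)\<close> to its
      image.\<close>
    have "m * (x' - D) \<le> m * (l * D - l * x + 1 - (a + b) * x - D)"
      using h m_pos by (intro mult_left_mono) (auto simp: x'_def)
    also have "\<dots> = m * (- (a + b + l) * x)" using D_eq(1) by (simp add: algebra_simps)
    also have "\<dots> = - (a * b) * x" using m_eq by algebra
    finally show ?thesis using 1 2 by (simp add: T_def f)
  qed
qed

section \<open>The fixed point inside the triangle, and the unstable manifold\<close>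

lemma convex_T: "convex T"
proof -
  have "T = {P. inner (l, 1) P \<le> l * D} \<inter> {P. inner (lam, 1) P \<ge> - lam / (lam - 1)}
      \<inter> {P. inner (m, - 1) P \<le> m * D}"
    by (auto simp: T_def algebra_simps)
  then show ?thesis
    by (simp only:) (intro convex_Int convex_halfspace_le convex_halfspace_ge)
qed

definition "U = {P. snd P + l * fst P < l * D \<and> snd P + lam * fst P > - lam / (lam - 1)
  \<and> snd P > m * (fst P - D)}"

lemma open_U: "open U"
  unfolding U_def by (intro open_Collect_conj open_Collect_less continuous_intros)

lemma U_subset_T: "U \<subseteq> T"
  by (auto simp: U_def T_def)

lemma X_in_U: "X \<in> U"
proof -
  define q where "q = 1 / ((1 + a) * (1 + b))"
  have "(1 + a) * (1 + b) > 0" using a b by simp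
  then have q: "q > 0" "q * (1 + a + b + a * b) = 1"
    by (auto simp: q_def) (simp add: field_simps)
  have X: "X = (q, - (a * b) * q)" by (simp add: X_eq q_def)
  have abq: "a * b * q > 0" "a * q > 0" "b * q > 0" using a b q by auto
  have q1: "q + a * q + b * q + a * b * q = 1" using q by (simp add: algebra_simps)
  have "q < D" using abq q1 D_eq by linarith
  then have "l * q < l * D" using l by simp
  then have 1: "- (a * b) * q + l * q < l * D" using abq unfolding mult_minus_left by linarith
  have "lam / (lam - 1) > 1" "lam * q > 0" using lam q by auto
  then have 2: "- (a * b) * q + lam * q > - lam / (lam - 1)"
    using abq q1 q unfolding mult_minus_left minus_divide_left[symmetric] by linarith
  \<comment> \<open>Since \<open>a * b = m * (a + b + l)\<close>, the bottom-edge inequality at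
    \<open>X\<close> reduces to \<open>q + (a + b + l) * q < D\<close>.\<close>
  have "q + (a + b + l) * q = 1 - a * b * q + l * q" using q1 by (simp add: algebra_simps)
  also have "\<dots> < 1 + l * D" using abq \<open>l * q < l * D\<close> by linarith
  also have "\<dots> = D" using D_eq by simp
  finally have "m * ((a + b + l) * q) < m * (D - q)" using m_pos by simp
  moreover have "m * ((a + b + l) * q) = a * b * q" using m_eq by (metis mult.assoc)
  ultimately have 3: "- (a * b) * q > m * (q - D)" by (simp add: algebra_simps)
  show ?thesis using 1 2 3 by (simp add: U_def X)
qed

lemma f_pow_T: "P \<in> T \<Longrightarrow> (f ^^ n) P \<in> T"
  by (induction n) (auto intro: f_T)

text \<open>A backward orbit converging to \<open>X\<close> enters the neighbourhood
  \<open>U\<close>; forward invariance then brings membership in \<open>T\<close> back to its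
  starting point.\<close>

lemma unstable_subset_T: "unstable_manifold f X \<subseteq> T"
proof
  fix P assume "P \<in> unstable_manifold f X"
  then have "(\<lambda>n. (inv f ^^ n) P) \<longlonglongrightarrow> X" by (simp add: unstable_manifold_def)
  then have "eventually (\<lambda>n. (inv f ^^ n) P \<in> U) sequentially"
    using open_U X_in_U by (simp add: topological_tendstoD)
  then obtain n where "(inv f ^^ n) P \<in> T"
    using U_subset_T by (auto simp: eventually_sequentially)
  then have "(f ^^ n) ((inv f ^^ n) P) \<in> T" by (rule f_pow_T)
  moreover have "(f ^^ n) ((inv f ^^ n) P) = P" for n
  proof (induction n arbitrary: P)
    case (Suc n)
    have 1: "(inv f ^^ Suc n) P = (inv f ^^ n) (inv f P)"
      by (simp only: funpow_Suc_right o_apply)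
    show ?case unfolding 1 using Suc by (simp add: surj_f_inv_f[OF surj_f])
  qed simp
  ultimately show "P \<in> T" by simp
qed

section \<open>The three half-planes as a convex hull\<close>

lemma triangle_T: "filled_triangle T"
proof -
  define e where "e = lam / (lam - 1)"
  have e: "e > 1" using lam by (simp add: e_def)
  have lamm: "lam + m > 0" "lam - l > 0" using lam m_pos l_less_1 by auto
  \<comment> \<open>\<open>(zx, zy)\<close> is where the stable line of \<open>Y\<close> meets the
    bottom line; \<open>(yx, yy)\<close> is where the two lines of \<open>Y\<close> meet, hence
    \<open>Y\<close> itself.\<close>
  define zx where "zx = (m * D - e) / (lam + m)"
  define zy where "zy = m * (zx - D)"
  define yx where "yx = - (l * D + e) / (lam - l)"
  define yy where "yy = l * D - l * yx"
  have zx: "(lam + m) * zx = m * D - e" using lamm by (simp add: zx_def)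
  have zl: "zy = - e - lam * zx" using zx by (simp add: zy_def algebra_simps)
  have yx: "(lam - l) * yx = - (l * D + e)" using lamm by (simp add: yx_def)
  have yl: "yy = - e - lam * yx" using yx by (simp add: yy_def algebra_simps)
  have yD: "yx < D"
  proof -
    have "yx < 0" using lamm e D_eq by (auto simp: yx_def divide_neg_pos)
    then show ?thesis using D_eq by simp
  qed
  have zD: "zx < D"
  proof -
    have "(lam + m) * zx < (lam + m) * D" unfolding zx using lam e D_eq by (simp add: algebra_simps add_pos_pos)
    then show ?thesis using lamm by simp
  qed
  have yz: "yx < zx"
  proof -
    have k: "- (l * D + e) * (lam + m) < (m * D - e) * (lam - l)"
    proof -
      have "(m * D - e) * (lam - l) + (l * D + e) * (lam + m) = (m + l) * (lam * D + e)"
        by (simp add: algebra_simps)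
      moreover have "(m + l) * (lam * D + e) > 0"
        using m_pos l lam D_eq e by (intro mult_pos_pos add_pos_pos) auto
      ultimately show ?thesis by (simp add: algebra_simps)
    qed
    show ?thesis unfolding yx_def zx_def using k lamm by (simp add: divide_simps mult.commute)
  qed
  \<comment> \<open>Each edge's cross product is a positive multiple of the slack in one inequality
    of \<open>T\<close>.\<close>
  have cr1: "(yx - D) * (y - 0) - (yy - 0) * (x - D) = (D - yx) * (l * D - (y + l * x))" for x y
    by (simp add: yy_def algebra_simps)
  have cr2: "(zx - yx) * (y - yy) - (zy - yy) * (x - yx) = (zx - yx) * (y + lam * x + e)" for x y
    by (simp add: yl zl algebra_simps)
  have cr3: "(D - zx) * (y - zy) - (0 - zy) * (x - zx) = (D - zx) * (y - m * (x - D))" for x y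
    by (simp add: zy_def algebra_simps)
  have z1: "l * D - (zy + l * zx) > 0"
  proof -
    have "l * D - (zy + l * zx) = (m + l) * (D - zx)" by (simp add: zy_def algebra_simps)
    then show ?thesis using zD m_pos l by simp
  qed
  have orient: "(yx - D) * (zy - 0) - (yy - 0) * (zx - D) > 0"
    unfolding cr1 using yD z1 by simp
  have y3: "yy \<ge> m * (yx - D)"
  proof -
    have "yy - m * (yx - D) = (m + l) * (D - yx)" by (simp add: yy_def algebra_simps)
    moreover have "(m + l) * (D - yx) \<ge> 0" using yD m_pos l by simp
    ultimately show ?thesis by linarith
  qed
  have "T = convex hull {(D, 0), (yx, yy), (zx, zy)}"
  proof
    have "lam * D > 0" using lam D_eq by simp
    then have "(D, 0) \<in> T" "(yx, yy) \<in> T" "(zx, zy) \<in> T"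
      using y3 z1 e by (auto simp: T_def e_def[symmetric] yl[symmetric])
        (use yl zl in \<open>auto simp: yy_def zy_def\<close>)
    then show "convex hull {(D, 0), (yx, yy), (zx, zy)} \<subseteq> T"
      by (intro hull_minimal convex_T) auto
    show "T \<subseteq> convex hull {(D, 0), (yx, yy), (zx, zy)}"
    proof
      fix P assume P: "P \<in> T"
      obtain x y where xy: "P = (x, y)" by fastforce
      show "P \<in> convex hull {(D, 0), (yx, yy), (zx, zy)}"
        unfolding xy by (rule mem_triangle_hull, rule orient, unfold cr1 cr2 cr3)
          (use P yD zD yz in \<open>auto simp: T_def xy e_def[symmetric]\<close>)
    qed
  qed
  then show ?thesis
    unfolding filled_triangle_def using not_collinear_if_cross_pos[OF orient] by blast
qed

section \<open>The stable line of \<open>X\<close> inside the triangle\<close>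

lemma W_f: "f P \<in> W \<Longrightarrow> P \<in> W"
proof -
  assume "f P \<in> W"
  then have "(\<lambda>n. (f ^^ Suc n) P) \<longlonglongrightarrow> X"
    unfolding W_def stable_manifold_def by (simp add: funpow_Suc_right del: funpow.simps)
  then show "P \<in> W"
    unfolding W_def stable_manifold_def by (simp add: LIMSEQ_imp_Suc)
qed

text \<open>On its stable line, the right branch of the map acts around the fixed point as
  multiplication by \<open>-b\<close>; the bound on the abscissa keeps the orbit in the right half-plane.\<close>

lemma stable_line:
  assumes x: "0 \<le> x" "x \<le> 1 / ((1 + a) * b)"
  shows "(x, a * (x - 1 / (1 + a))) \<in> W"
proof -
  define q where "q = 1 / ((1 + a) * (1 + b))"
  have q: "q > 0" "q * ((1 + a) * (1 + b)) = 1" using a b by (auto simp: q_def)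
  have q1: "1 / (1 + a) = q * (1 + b)" using a b by (simp add: q_def)
  have q2: "1 / ((1 + a) * b) = q * (1 + b) / b" using a b by (simp add: q_def)
  have b1: "b < 1" using lb l by simp
  define L where "L = (\<lambda>t. (q + t, a * (t - q * b)))"
  have LX: "X = L 0" by (simp add: L_def X_eq q_def)
  have step: "f (L t) = L (- b * t)" if "t \<ge> - q" for t
  proof -
    have "a * (t - q * b) + 1 - (a + b) * (q + t) = q - b * t"
      using q(2) by (simp add: algebra_simps)
    moreover have "f (L t) = (a * (t - q * b) + 1 - (a + b) * (q + t), - (a * b) * (q + t))"
      using that by (subst f_right) (auto simp: L_def)
    ultimately show ?thesis by (simp add: L_def algebra_simps)
  qed
  define t where "t = x - q"
  have t: "- q \<le> t" "b * t \<le> q"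
    using x b unfolding q2 by (auto simp: t_def field_simps)
  \<comment> \<open>The first inequality keeps the abscissa of \<open>L s\<close> nonnegative, the
    second that of its image; \<open>b < 1\<close> makes the pair invariant.\<close>
  have bound: "- q \<le> s \<and> b * s \<le> q \<Longrightarrow> - q \<le> - b * s \<and> b * (- b * s) \<le> q" for s
  proof -
    assume s: "- q \<le> s \<and> b * s \<le> q"
    have "b * b \<le> 1" using b b1 by (simp add: mult_le_one)
    then have "b * b * q \<le> q" using q by simp
    moreover have "b * b * (- s) \<le> b * b * q" using s b by (intro mult_left_mono) auto
    ultimately show ?thesis using s by (simp add: algebra_simps)
  qed
  have it: "(f ^^ n) (L t) = L ((- b) ^ n * t) \<and> - q \<le> (- b) ^ n * t \<and> b * ((- b) ^ n * t) \<le> q" for n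
  proof (induction n)
    case (Suc n)
    then show ?case using step[of "(- b) ^ n * t"] bound[of "(- b) ^ n * t"]
      by (simp add: mult.assoc)
  qed (use t in auto)
  have "(\<lambda>n. (- b) ^ n * t) \<longlonglongrightarrow> 0"
    using b b1 by (intro tendsto_mult_left_zero LIMSEQ_power_zero) auto
  then have "(\<lambda>n. L ((- b) ^ n * t)) \<longlonglongrightarrow> L 0"
    unfolding L_def by (intro tendsto_intros) auto
  then have "L t \<in> W"
    using it by (simp add: W_def stable_manifold_def LX)
  moreover have "(x, a * (x - 1 / (1 + a))) = L t"
    by (simp add: L_def t_def q1 algebra_simps)
  ultimately show ?thesis by simp
qed

text \<open>The stable line of \<open>X\<close> meets the axis at height
  \<open>- a / (1 + a)\<close>, the bottom line at \<open>- m * D\<close>. Their order is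
  \<open>(1 - l - b) * (a + l) > 0\<close> multiplied out.\<close>

lemma T_axis: assumes "P \<in> T" "fst P = 0" shows "snd P > - a / (1 + a)"
proof -
  have h: "snd P \<ge> - m * D" using assms by (simp add: T_def)
  have "(1 - l - b) * (a + l) > 0" using lb a l by simp
  then have "b * (1 + a) < (a + b + l) * (1 - l)" by (simp add: algebra_simps)
  moreover define N where "N = (a + b + l) * (1 - l)"
  ultimately have "a * (b * (1 + a)) < a * N" using a by simp
  moreover have "N > 0" using a b l l_less_1 by (simp add: N_def)
  ultimately have "a * b / N < a / (1 + a)"
    using a by (simp add: pos_divide_less_eq pos_less_divide_eq mult.assoc)
  then show ?thesis using h by (simp add: m_def D_def N_def)
qed

text \<open>The top line cuts off the stable line of \<open>X\<close>; by \<open>l + b < 1\<close>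
  this happens within the range covered by \<open>stable_line\<close>.\<close>

lemma T_stable_line:
  assumes "P \<in> T" "fst P \<ge> 0" "snd P = a * (fst P - 1 / (1 + a))"
  shows "P \<in> W"
proof -
  define x where "x = fst P"
  have "a * (x - 1 / (1 + a)) + l * x \<le> l * D"
    using assms by (simp add: T_def x_def)
  then have 1: "(a + l) * x \<le> l * D + a / (1 + a)" by (simp add: algebra_simps)
  have "b * (a + l) \<le> (a + l) * (1 - l)" using lb a l by (simp add: mult.commute)
  then have "b * (l * (1 + a) + a * (1 - l)) \<le> (a + l) * (1 - l)"
    by (simp add: algebra_simps)
  then have 2: "l * D + a / (1 + a) \<le> (a + l) * (1 / ((1 + a) * b))"
    using a b l l_less_1 by (simp add: D_def divide_simps) (simp add: algebra_simps)
  have "x \<le> 1 / ((1 + a) * b)"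
    using order_trans[OF 1 2] a l by (simp only: mult_le_cancel_left_pos add_pos_pos)
  then have "(x, a * (x - 1 / (1 + a))) \<in> W" using assms by (intro stable_line) (auto simp: x_def)
  then show ?thesis using assms by (metis prod.collapse x_def)
qed

lemma segment_point:
  fixes g :: "real \<times> real \<Rightarrow> real"
  assumes "g P \<le> 0" "g Q \<ge> 0" "continuous_on (closed_segment P Q) g"
  obtains S where "S \<in> closed_segment P Q" "g S = 0"
proof -
  have "connected (g ` closed_segment P Q)"
    using assms(3) connected_segment(1) by (rule connected_continuous_image)
  moreover have "g P \<in> g ` closed_segment P Q" "g Q \<in> g ` closed_segment P Q"
    by (rule imageI, rule ends_in_segment)+
  ultimately have "0 \<in> g ` closed_segment P Q"
    using assms(1,2) by (rule connectedD_interval)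
  then show ?thesis using that by (metis imageE)
qed

text \<open>By \<open>T_axis\<close> the segment passes the axis above the stable line of
  \<open>X\<close>, while \<open>R\<close> is on or below it. The crossing is therefore in the right
  half-plane and in \<open>T\<close>, where the line belongs to \<open>W\<close>.\<close>

lemma segment_hits_W:
  assumes "P \<in> T" "R \<in> T" "fst P \<le> 0" "fst R \<ge> 0" "a * (fst R - 1 / (1 + a)) - snd R \<ge> 0"
  obtains S where "S \<in> closed_segment P R" "S \<in> W"
proof -
  obtain S where S: "S \<in> closed_segment P R" "fst S = 0"
    by (rule segment_point[of fst P R]) (use assms in \<open>auto intro!: continuous_intros\<close>)
  have ST: "S \<in> T" using S assms convex_T convex_contains_segment by blast
  obtain Q where Q: "Q \<in> closed_segment S R" "a * (fst Q - 1 / (1 + a)) - snd Q = 0"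
    by (rule segment_point[of "\<lambda>Q. a * (fst Q - 1 / (1 + a)) - snd Q" S R])
      (use T_axis[OF ST S(2)] assms S in \<open>auto intro!: continuous_intros\<close>)
  have "Q \<in> T" using Q ST assms convex_T convex_contains_segment by blast
  moreover have "convex {Q :: real \<times> real. fst Q \<ge> 0}"
    using convex_halfspace_ge[of 0 "(1, 0) :: real \<times> real"] by (simp add: inner_prod_def)
  then have "fst Q \<ge> 0" using Q S assms
    by (auto dest!: closed_segment_subset[of S _ R, rotated 2])
  ultimately have "Q \<in> W" using T_stable_line Q by simp
  moreover have "Q \<in> closed_segment P R"
    using Q S by (meson closed_segment_subset convex_closed_segment ends_in_segment(2) subsetD)
  ultimately show ?thesis using that by blast
qed

section \<open>Expansion of segments with slope in the cone\<close>

text \<open>The extreme slopes \<open>- l\<close> and \<open>b\<close> are the unstable directions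
  of the left and the right matrix. Ordering the endpoints by abscissa makes
  \<open>fst Q - fst P\<close> the extent to be tracked.\<close>

definition "good P Q \<longleftrightarrow> P \<in> T \<and> Q \<in> T \<and> fst P < fst Q
  \<and> - l * (fst Q - fst P) \<le> snd Q - snd P \<and> snd Q - snd P \<le> b * (fst Q - fst P)
  \<and> closed_segment P Q \<inter> W = {}"

lemma segment_coords:
  assumes "S \<in> closed_segment P Q"
  obtains u :: real where "0 \<le> u" "u \<le> 1" "fst S = (1 - u) * fst P + u * fst Q"
    "snd S = (1 - u) * snd P + u * snd Q"
  using assms by (force simp: in_segment)

lemma good_sub:
  assumes g: "good P Q" and S: "S \<in> closed_segment P Q"
  shows "fst P < fst S \<Longrightarrow> good P S" "fst S < fst Q \<Longrightarrow> good S Q"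
proof -
  obtain u where u: "0 \<le> u" "u \<le> 1" "fst S = (1 - u) * fst P + u * fst Q"
    "snd S = (1 - u) * snd P + u * snd Q"
    using S by (rule segment_coords)
  have ST: "S \<in> T" using S g convex_T convex_contains_segment unfolding good_def by blast
  have sub: "closed_segment P S \<subseteq> closed_segment P Q" "closed_segment S Q \<subseteq> closed_segment P Q"
    using S by (simp_all add: closed_segment_subset)
  have d: "fst S - fst P = u * (fst Q - fst P)" "snd S - snd P = u * (snd Q - snd P)"
    "fst Q - fst S = (1 - u) * (fst Q - fst P)" "snd Q - snd S = (1 - u) * (snd Q - snd P)"
    by (auto simp: u algebra_simps)
  have A: "- l * (fst Q - fst P) \<le> snd Q - snd P" and B: "snd Q - snd P \<le> b * (fst Q - fst P)"
    using g by (auto simp: good_def)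
  have e: "u * (- l * (fst Q - fst P)) \<le> u * (snd Q - snd P)"
    "u * (snd Q - snd P) \<le> u * (b * (fst Q - fst P))"
    "(1 - u) * (- l * (fst Q - fst P)) \<le> (1 - u) * (snd Q - snd P)"
    "(1 - u) * (snd Q - snd P) \<le> (1 - u) * (b * (fst Q - fst P))"
    by (rule mult_left_mono[OF A] mult_left_mono[OF B], use u in simp)+
  show "fst P < fst S \<Longrightarrow> good P S"
    using g ST sub e unfolding good_def d by (auto simp: mult.left_commute)
  show "fst S < fst Q \<Longrightarrow> good S Q"
    using g ST sub e unfolding good_def d by (auto simp: mult.left_commute)
qed

lemma affine_image_avoids_W:
  assumes "closed_segment P Q \<inter> W = {}"
    and "\<And>u. 0 \<le> u \<Longrightarrow> u \<le> 1 \<Longrightarrow> f ((1 - u) *\<^sub>R P + u *\<^sub>R Q) = (1 - u) *\<^sub>R f P + u *\<^sub>R f Q"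
  shows "closed_segment (f P) (f Q) \<inter> W = {}"
proof -
  have "R \<in> f ` closed_segment P Q" if R: "R \<in> closed_segment (f P) (f Q)" for R
  proof -
    obtain u where u: "0 \<le> u" "u \<le> 1" "R = (1 - u) *\<^sub>R f P + u *\<^sub>R f Q"
      using R by (auto simp: in_segment)
    have "R = f ((1 - u) *\<^sub>R P + u *\<^sub>R Q)" unfolding u(3) by (rule assms(2)[OF u(1,2), symmetric])
    moreover have "(1 - u) *\<^sub>R P + u *\<^sub>R Q \<in> closed_segment P Q"
      using u(1,2) unfolding in_segment by blast
    ultimately show ?thesis by (rule image_eqI)
  qed
  then show ?thesis using assms(1) W_f by blast
qed

text \<open>The image has extent \<open>(lam + l) * d + e\<close>, least in the unstable direction
  \<open>e = - l * d\<close>; its slope lies in \<open>[-l, 0]\<close>.\<close>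

lemma good_left:
  assumes g: "good P Q" and Q: "fst Q \<le> 0"
  shows "good (f P) (f Q)" "fst (f Q) - fst (f P) \<ge> lam * (fst Q - fst P)"
proof -
  define d e where "d = fst Q - fst P" and "e = snd Q - snd P"
  have de: "d > 0" "e \<ge> - l * d" using g by (auto simp: good_def d_def e_def)
  have P: "fst P \<le> 0" using g Q by (simp add: good_def)
  have x: "fst (f Q) - fst (f P) = (lam + l) * d + e" and y: "snd (f Q) - snd (f P) = - (lam * l) * d"
    using P Q by (simp_all add: f_left d_def e_def algebra_simps)
  have ge: "(lam + l) * d + e \<ge> lam * d" using de by (simp add: algebra_simps)
  have ld: "lam * d > 0" using lam de by simp
  have "l * ((lam + l) * d + e) \<ge> l * (lam * d)" using ge l by simp
  moreover have "b * ((lam + l) * d + e) \<ge> 0" using ge ld b by simp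
  moreover have "lam * l * d \<ge> 0" using lam l de by simp
  moreover have "closed_segment (f P) (f Q) \<inter> W = {}"
  proof (rule affine_image_avoids_W)
    show "closed_segment P Q \<inter> W = {}" using g by (simp add: good_def)
    fix u :: real assume u: "0 \<le> u" "u \<le> 1"
    have "(1 - u) * fst P + u * fst Q \<le> 0"
      using u P Q by (intro add_nonpos_nonpos) (auto simp: mult_le_0_iff)
    then show "f ((1 - u) *\<^sub>R P + u *\<^sub>R Q) = (1 - u) *\<^sub>R f P + u *\<^sub>R f Q"
      using P Q by (simp add: f_left prod_eq_iff algebra_simps)
  qed
  moreover have "fst (f P) < fst (f Q)" using x ge ld by linarith
  ultimately show "good (f P) (f Q)"
    using g unfolding good_def x y by (auto simp: f_T algebra_simps)
  show "fst (f Q) - fst (f P) \<ge> lam * (fst Q - fst P)" using x ge by (simp add: d_def)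
qed

text \<open>The right branch reverses horizontal order, so the endpoints swap. The extent
  \<open>(a + b) * d - e\<close> is least at \<open>e = b * d\<close>, and the new slope lies in
  \<open>[0, b]\<close>.\<close>

lemma good_right:
  assumes g: "good P Q" and P: "fst P \<ge> 0"
  shows "good (f Q) (f P)" "fst (f P) - fst (f Q) \<ge> a * (fst Q - fst P)"
proof -
  define d e where "d = fst Q - fst P" and "e = snd Q - snd P"
  have de: "d > 0" "e \<le> b * d" using g by (auto simp: good_def d_def e_def)
  have Q: "fst Q \<ge> 0" using g P by (simp add: good_def)
  have x: "fst (f P) - fst (f Q) = (a + b) * d - e" and y: "snd (f P) - snd (f Q) = a * b * d"
    using P Q by (simp_all add: f_right d_def e_def algebra_simps)
  have ge: "(a + b) * d - e \<ge> a * d" using de by (simp add: algebra_simps)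
  have ad: "a * d > 0" using a de by simp
  have "b * ((a + b) * d - e) \<ge> b * (a * d)" using ge b by simp
  moreover have "l * ((a + b) * d - e) \<ge> 0" using ge ad l by simp
  moreover have "a * b * d \<ge> 0" using a b de by simp
  moreover have "closed_segment (f P) (f Q) \<inter> W = {}"
  proof (rule affine_image_avoids_W)
    show "closed_segment P Q \<inter> W = {}" using g by (simp add: good_def)
    fix u :: real assume u: "0 \<le> u" "u \<le> 1"
    have "(1 - u) * fst P + u * fst Q \<ge> 0"
      using u P Q by (intro add_nonneg_nonneg) auto
    then show "f ((1 - u) *\<^sub>R P + u *\<^sub>R Q) = (1 - u) *\<^sub>R f P + u *\<^sub>R f Q"
      using P Q by (simp add: f_right prod_eq_iff algebra_simps)
  qed
  then have "closed_segment (f Q) (f P) \<inter> W = {}" by (simp add: closed_segment_commute)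
  moreover have "fst (f Q) < fst (f P)" using x ge ad by linarith
  ultimately show "good (f Q) (f P)"
    using g unfolding good_def x y by (auto simp: f_T algebra_simps)
  show "fst (f P) - fst (f Q) \<ge> a * (fst Q - fst P)" using x ge by (simp add: d_def)
qed

text \<open>The two images of a segment cut by the switching line end at the same point on the
  right of the stable line of \<open>X\<close>, and they cannot cross that line. So they stay in the right half-plane,
  and one more iterate of the longer one is longer by the factor \<open>J1\<close>.\<close>

lemma good_cross:
  assumes g: "good P Q" and "fst P < 0" "fst Q > 0"
  obtains P' Q' where "good P' Q'"
    "fst Q' - fst P' \<ge> lam * a\<^sup>2 / (lam + a) * (fst Q - fst P)"
proof -
  obtain S where S: "S \<in> closed_segment P Q" "fst S = 0"
    by (rule segment_point[of fst P Q]) (use assms in \<open>auto intro!: continuous_intros\<close>)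
  have ST: "S \<in> T" using S g convex_T convex_contains_segment unfolding good_def by blast
  have s: "snd S > - a / (1 + a)" using T_axis ST S by simp
  have fS: "f S = (snd S + 1, 0)" using S by (simp add: f_left)
  have key: "fst R > 0" if "good R (f S)" for R
  proof (rule ccontr)
    assume "\<not> fst R > 0"
    \<comment> \<open>By \<open>T_axis\<close>, \<open>f S\<close> lies on the horizontal axis to
      the right of \<open>1 / (1 + a)\<close>, where the stable line of \<open>X\<close> meets that
      axis; so \<open>segment_hits_W\<close> applies.\<close>
    moreover have "a / (1 + a) < 1" "1 - 1 / (1 + a) = a / (1 + a)" using a by (auto simp: field_simps)
    then have "fst (f S) \<ge> 0" "fst (f S) - 1 / (1 + a) \<ge> 0" using s fS by auto
    then have "fst (f S) \<ge> 0" "a * (fst (f S) - 1 / (1 + a)) - snd (f S) \<ge> 0"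
      using a fS by auto
    ultimately show False
      using that segment_hits_W[of R "f S"] unfolding good_def by (metis disjoint_iff not_less)
  qed
  have gL: "good P S" and gR: "good S Q" using good_sub[OF g S(1)] S assms by auto
  note L1 = good_left[OF gL] and R1 = good_right[OF gR]
  have L: "good (f P) (f S)" "fst (f S) - fst (f P) \<ge> lam * (- fst P)"
    and R: "good (f Q) (f S)" "fst (f S) - fst (f Q) \<ge> a * fst Q"
    using L1 R1 S by auto
  note L2 = good_right[OF L(1) less_imp_le[OF key[OF L(1)]]]
    and R2 = good_right[OF R(1) less_imp_le[OF key[OF R(1)]]]
  define K where "K = lam * a\<^sup>2 / (lam + a)"
  have K: "K * (lam + a) = lam * a\<^sup>2" using lam a by (simp add: K_def)
  have "a * (lam * (- fst P)) \<le> a * (fst (f S) - fst (f P))" using L(2) a by (intro mult_left_mono) auto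
  then have l3: "fst (f (f P)) - fst (f (f S)) \<ge> a * (lam * (- fst P))" using L2(2) by linarith
  have "a * (a * fst Q) \<le> a * (fst (f S) - fst (f Q))" using R(2) a by (intro mult_left_mono) auto
  then have r3: "fst (f (f Q)) - fst (f (f S)) \<ge> a * (a * fst Q)" using R2(2) by linarith
  \<comment> \<open>The factor \<open>K\<close> belongs to the cut that makes both pieces equally
    long after two iterates. If both fell short, adding the inequalities with weights
    \<open>a\<close> and \<open>lam\<close> would contradict
    \<open>K * (lam + a) = lam * a\<^sup>2\<close>.\<close>
  have "a * (lam * (- fst P)) \<ge> K * (fst Q - fst P) \<or> a * (a * fst Q) \<ge> K * (fst Q - fst P)"
  proof (rule ccontr)
    assume "\<not> ?thesis"
    then have "a * (a * (lam * (- fst P))) < a * (K * (fst Q - fst P))"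
      "lam * (a * (a * fst Q)) < lam * (K * (fst Q - fst P))"
      using a lam by (intro mult_strict_left_mono; linarith)+
    then have "lam * a\<^sup>2 * (fst Q - fst P) < K * (lam + a) * (fst Q - fst P)"
      by (simp add: algebra_simps power2_eq_square)
    then show False using K by simp
  qed
  then have "fst (f (f P)) - fst (f (f S)) \<ge> K * (fst Q - fst P)
      \<or> fst (f (f Q)) - fst (f (f S)) \<ge> K * (fst Q - fst P)"
    using l3 r3 by linarith
  then show ?thesis
    using that[OF L2(1)] that[OF R2(1)] unfolding K_def by blast
qed

text \<open>One factor for all positions relative to the switching line, so that iteration gives
  geometric growth.\<close>

lemma good_grow:
  obtains r where "r > 1"
    "\<And>P Q. good P Q \<Longrightarrow> \<exists>P' Q'. good P' Q' \<and> fst Q' - fst P' \<ge> r * (fst Q - fst P)"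
proof -
  define r where "r = min (min lam a) (lam * a\<^sup>2 / (lam + a))"
  have r: "r > 1" using lam a J by (simp add: r_def)
  have "\<exists>P' Q'. good P' Q' \<and> fst Q' - fst P' \<ge> r * (fst Q - fst P)" if g: "good P Q" for P Q
  proof -
    have d: "fst Q - fst P \<ge> 0" using g by (simp add: good_def)
    have m: "r * (fst Q - fst P) \<le> k * (fst Q - fst P)" if "r \<le> k" for k
      using that d by (rule mult_right_mono)
    consider "fst Q \<le> 0" | "fst P \<ge> 0" | "fst P < 0" "fst Q > 0" by linarith
    then show ?thesis
    proof cases
      case 1
      have "r \<le> lam" by (simp add: r_def)
      then show ?thesis using good_left[OF g 1] m order_trans by blast
    next
      case 2
      have "r \<le> a" by (simp add: r_def)
      then show ?thesis using good_right[OF g 2] m order_trans by blast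
    next
      case 3
      have "r \<le> lam * a\<^sup>2 / (lam + a)" by (simp add: r_def)
      from m[OF this] show ?thesis using good_cross[OF g 3] order_trans by metis
    qed
  qed
  then show ?thesis using r that by blast
qed

lemma T_fst_bounded: obtains B where "\<And>P. P \<in> T \<Longrightarrow> \<bar>fst P\<bar> \<le> B"
proof -
  obtain p q r where "T = convex hull {p, q, r}" using triangle_T by (auto simp: filled_triangle_def)
  then have "bounded T"
    by (simp add: bounded_convex_hull finite_imp_bounded)
  then have "bounded (fst ` T)" by (rule bounded_fst)
  then obtain B where B: "\<forall>x\<in>fst ` T. norm x \<le> B" unfolding bounded_iff by blast
  show ?thesis by (rule that[of B]) (use B in simp)
qed

lemma not_good: "\<not> good P Q"
proof
  assume g: "good P Q"
  obtain r where r: "r > 1" and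
    grow: "\<And>P Q. good P Q \<Longrightarrow> \<exists>P' Q'. good P' Q' \<and> fst Q' - fst P' \<ge> r * (fst Q - fst P)"
    using good_grow by blast
  obtain B where B: "\<And>P. P \<in> T \<Longrightarrow> \<bar>fst P\<bar> \<le> B" using T_fst_bounded by blast
  define d where "d = fst Q - fst P"
  have d: "d > 0" using g by (simp add: good_def d_def)
  have it: "\<exists>P' Q'. good P' Q' \<and> fst Q' - fst P' \<ge> r ^ n * d" for n
  proof (induction n)
    case 0
    show ?case by (rule exI[of _ P], rule exI[of _ Q]) (use g in \<open>simp add: d_def\<close>)
  next
    case (Suc n)
    then obtain P1 Q1 where 1: "good P1 Q1" "fst Q1 - fst P1 \<ge> r ^ n * d" by blast
    then have "r * (fst Q1 - fst P1) \<ge> r ^ Suc n * d" using r by simp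
    then show ?case using grow[OF 1(1)] by (meson order_trans)
  qed
  obtain n where n: "r ^ n > 2 * B / d" using r real_arch_pow by blast
  obtain P' Q' where 1: "good P' Q'" "fst Q' - fst P' \<ge> r ^ n * d" using it by blast
  moreover have "r ^ n * d > 2 * B" using n d by (simp add: field_simps)
  moreover have "\<bar>fst P'\<bar> \<le> B" "\<bar>fst Q'\<bar> \<le> B" using 1(1) B by (auto simp: good_def)
  ultimately show False by linarith
qed

section \<open>Density in the triangle\<close>

text \<open>A short horizontal segment in \<open>T\<close> has slope 0, inside the cone; it fails to
  be \<open>good\<close> only by meeting \<open>W\<close>.\<close>

lemma interior_T_subset: "interior T \<subseteq> closure (W \<inter> T)"
proof
  fix P assume P: "P \<in> interior T"
  then obtain e0 where e0: "e0 > 0" "cball P e0 \<subseteq> T" by (auto simp: mem_interior_cball)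
  show "P \<in> closure (W \<inter> T)"
    unfolding closure_approachable
  proof (intro allI impI)
    fix e :: real assume e: "e > 0"
    define t where "t = min e0 (e / 2)"
    have t: "t > 0" "t \<le> e0" "t < e" using e e0 by (auto simp: t_def)
    define Q where "Q = P + (t, 0)"
    have "dist P Q = t" using t by (simp add: Q_def dist_norm norm_prod_def)
    then have PQ: "closed_segment P Q \<subseteq> cball P t"
      using t by (intro closed_segment_subset) auto
    then have sub: "closed_segment P Q \<subseteq> T" using e0 t by (meson order_trans subset_cball)
    then have "P \<in> T" "Q \<in> T" by auto
    then have "closed_segment P Q \<inter> W \<noteq> {}"
      using not_good[of P Q] t l b by (auto simp: good_def Q_def)
    then obtain S where S: "S \<in> closed_segment P Q" "S \<in> W" by blast
    then have "S \<in> W \<inter> T" "dist S P < e"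
      using sub PQ t by (auto simp: dist_commute)
    then show "\<exists>y\<in>W \<inter> T. dist y P < e" by blast
  qed
qed

text \<open>A convex set with nonempty interior lies in the closure of that interior, so the
  boundary points follow.\<close>

lemma T_subset_closure: "T \<subseteq> closure (W \<inter> T)"
proof -
  have "interior T \<noteq> {}" using X_in_U interior_maximal[OF U_subset_T open_U] by blast
  then have "closure (interior T) = closure T" by (rule convex_closure_interior[OF convex_T])
  moreover have "closure (interior T) \<subseteq> closure (W \<inter> T)"
    using interior_T_subset by (intro closure_minimal) auto
  ultimately show ?thesis using closure_subset by blast
qed

lemma closed_T: "closed T"
proof -
  obtain p q r where "T = convex hull {p, q, r}" using triangle_T by (auto simp: filled_triangle_def)
  then show ?thesis by (simp add: compact_imp_closed compact_convex_hull finite_imp_compact)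
qed

lemma main: "\<exists>T. filled_triangle T \<and> closure (unstable_manifold f X) \<subseteq> T
    \<and> T \<subseteq> closure (stable_manifold f X \<inter> T)"
  using triangle_T closure_minimal[OF unstable_subset_T closed_T] T_subset_closure
  by (intro exI[of _ T]) (simp add: W_def)

end

section \<open>From trace and determinant to eigenvalues\<close>

text \<open>The number 1 separates the roots since
  \<open>(u - 1) * (1 - s) = t - d - 1 > 0\<close>.\<close>

lemma quadratic_roots:
  fixes t d :: real
  assumes "t > d + 1" "d > 0"
  defines "u \<equiv> (t + sqrt (t\<^sup>2 - 4 * d)) / 2" and "s \<equiv> (t - sqrt (t\<^sup>2 - 4 * d)) / 2"
  shows "u + s = t" "u * s = d" "u > 1" "0 < s" "s < 1"
proof -
  have "t\<^sup>2 > (d + 1)\<^sup>2" using assms by (intro power_strict_mono) auto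
  moreover have "(d + 1)\<^sup>2 - 4 * d = (d - 1)\<^sup>2" by (simp add: power2_eq_square algebra_simps)
  ultimately have disc: "t\<^sup>2 - 4 * d \<ge> 0" by (smt (verit) zero_le_power2)
  show sum: "u + s = t" by (simp add: u_def s_def field_simps)
  have "u * s = (t\<^sup>2 - (sqrt (t\<^sup>2 - 4 * d))\<^sup>2) / 4"
    by (simp add: u_def s_def field_simps power2_eq_square)
  then show prod: "u * s = d" using disc by simp
  have us: "u \<ge> s" using disc by (simp add: u_def s_def)
  then have "u > 0" using sum assms by linarith
  then show "0 < s" using prod assms by (metis zero_less_mult_pos)
  have p: "(u - 1) * (1 - s) > 0" using sum prod assms by (simp add: algebra_simps)
  then show "s < 1" using us by (smt (verit) zero_less_mult_iff)
  then show "u > 1" using p by (simp add: zero_less_mult_iff)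
qed

theorem theorem2p1:
  fixes tL dL tR dR :: real
  assumes "Phi tL dL tR dR"
    and "phiBYG tL dL tR dR > 0"
    and "J1 tL dL tR dR > 1"
    and "lamLs tL dL + \<bar>lamRs tR dR\<bar> < 1"
  shows "\<exists>T. filled_triangle T
      \<and> closure (unstable_manifold (bcnf tL dL tR dR) (fixX tR dR)) \<subseteq> T
      \<and> T \<subseteq> closure (stable_manifold (bcnf tL dL tR dR) (fixX tR dR) \<inter> T)"
proof -
  have P: "tL > dL + 1" "dL > 0" "- tR > dR + 1" "dR > 0" using assms(1) by (auto simp: Phi_def)
  define lam where "lam = lamLu tL dL"
  define l where "l = lamLs tL dL"
  define a where "a = - lamRu tR dR"
  define b where "b = - lamRs tR dR"
  have L: "lam + l = tL" "lam * l = dL" "lam > 1" "0 < l" "l < 1"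
    using quadratic_roots[OF P(1,2)] by (simp_all add: lam_def l_def lamLu_def lamLs_def)
  \<comment> \<open>The negated eigenvalues of the right matrix are the roots for trace
    \<open>- tR\<close>, so the same lemma covers both sides.\<close>
  have a': "a = (- tR + sqrt ((- tR)\<^sup>2 - 4 * dR)) / 2"
    and b': "b = (- tR - sqrt ((- tR)\<^sup>2 - 4 * dR)) / 2"
    by (simp_all add: a_def b_def lamRu_def lamRs_def field_simps)
  have R: "a + b = - tR" "a * b = dR" "a > 1" "0 < b" "b < 1"
    using quadratic_roots[OF P(3,4)] by (simp_all add: a' b')
  have tR: "tR = - (a + b)" using R by simp
  have ab: "\<bar>lamRs tR dR\<bar> = b" "\<bar>lamRu tR dR\<bar> = a" "(lamRu tR dR)\<^sup>2 = a\<^sup>2"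
    using R by (auto simp: a_def b_def)
  interpret byg lam l a b
  proof
    show "a * b - (- (a + b) + lam * l + a * b - (1 - (a + b)) * lam) * lam > 0"
      using assms(2) unfolding phiBYG_def lam_def[symmetric]
      unfolding L(2)[symmetric] R(2)[symmetric] tR by (simp add: algebra_simps)
    show "lam * a\<^sup>2 / (lam + a) > 1"
      using assms(3) unfolding J1_def ab lam_def[symmetric] .
    show "l + b < 1" using assms(4) unfolding ab l_def[symmetric] .
  qed (use L R in auto)
  show ?thesis
    using main unfolding f_def X_def L(1,2) R(2) tR[symmetric] .
qed

end
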